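(* Let $\mu\in(0,1)$. Consider the model $Y_i=\mathbf 1(X_i\in G)+\xi_i$, $i=1,\ldots,n$, with design $X_i=i/n$ and noise satisfying the assumptions in the context. The minimax risk on the class $\mathcal S(\mu)$ satisfies, asymptotically, $$\mathcal R_n(\mathcal S(\mu))\asymp_{\mu,\sigma}\frac1n.$$
   Context: The noise terms $\xi_1,\ldots,\xi_n$ are i.i.d. and subgaussian: for a constant $\sigma>0$, $\mathbb E[e^{u\xi_i}]\le e^{\sigma^2u^2/2}$ for all $u\in\mathbb R$. $\mathcal S(\mu)=\{[a,b]:0\le a\le b\le1,\ b-a\ge\mu\}$. $\mathbb E_G$ is the expectation when the unknown set is $G$; $|\cdot|$ is Lebesgue measure; $\triangle$ is symmetric difference; $\mathbf 1(\cdot)$ is the indicator function. A set estimator $\hat G_n$ is a subset of $[0,1]$ constructed from the observations $(X_1,Y_1),\ldots,(X_n,Y_n)$. For a class $\mathcal C$ of Borel subsets of $\mathbb R$, $\mathcal R_n(\mathcal C)=\inf_{\hat G_n}\sup_{G\in\mathcal C}\mathbb E_G[|G\triangle\hat G_n|]$, the infimum being over all set estimators based on $n$ observations. For sequences $A_n,B_n$ and a (possibly multidimensional) parameter $\vartheta$, $A_n\asymp_\vartheta B_n$ means that there are positive constants $c(\vartheta),C(\vartheta)$ depending on $\vartheta$ such that $c(\vartheta)B_n\le A_n\le C(\vartheta)B_n$ for $n$ large enough. *)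

theory Defs
  imports "HOL-Probability.Probability"
begin

text \<open>
  The i.i.d. noise is represented by its common law \<open>\<nu>\<close> on the real line; integrability of the
  exponentials is explicit because the Bochner integral of a non-integrable function is \<open>0\<close>.
\<close>

definition subgaussian_law :: "real \<Rightarrow> real measure \<Rightarrow> bool" where
  "subgaussian_law \<sigma> \<nu> \<longleftrightarrow>
     prob_space \<nu> \<and> sets \<nu> = sets borel \<and>
     (\<forall>u. integrable \<nu> (\<lambda>x. exp (u * x)) \<and>
          (\<integral>x. exp (u * x) \<partial>\<nu>) \<le> exp (\<sigma>\<^sup>2 * u\<^sup>2 / 2))"

definition segments :: "real \<Rightarrow> real set set" where
  "segments \<mu> = {{a..b} | a b. 0 \<le> a \<and> a \<le> b \<and> b \<le> 1 \<and> b - a \<ge> \<mu>}"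

definition design :: "nat \<Rightarrow> nat \<Rightarrow> real" where
  "design n i = real i / real n"

definition sample :: "nat \<Rightarrow> real set \<Rightarrow> (nat \<Rightarrow> real) \<Rightarrow> nat \<Rightarrow> real \<times> real" where
  "sample n G \<xi> = (\<lambda>i\<in>{1..n}. (design n i, indicator G (design n i) + \<xi> i))"

definition sample_space :: "nat \<Rightarrow> (nat \<Rightarrow> real \<times> real) measure" where
  "sample_space n = (\<Pi>\<^sub>M i\<in>{1..n}. borel)"

text \<open>
  An estimator is a function of the \<open>n\<close> observations only, with Lebesgue measurable values in
  \<open>[0,1]\<close>. The last condition, measurability of the loss against every Borel set, is what makes
  its risk well defined (the integral below would be a lower integral otherwise).
\<close>

definition set_estimators :: "nat \<Rightarrow> ((nat \<Rightarrow> real \<times> real) \<Rightarrow> real set) set" where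
  "set_estimators n = {g.
     (\<forall>s\<in>space (sample_space n). g s \<subseteq> {0..1} \<and> g s \<in> sets lebesgue) \<and>
     (\<forall>G\<in>sets borel.
        (\<lambda>s. emeasure lebesgue (sym_diff G (g s))) \<in> borel_measurable (sample_space n))}"

definition risk ::
  "real measure \<Rightarrow> nat \<Rightarrow> real set \<Rightarrow> ((nat \<Rightarrow> real \<times> real) \<Rightarrow> real set) \<Rightarrow> ennreal" where
  "risk \<nu> n G g =
     (\<integral>\<^sup>+\<xi>. emeasure lebesgue (sym_diff G (g (sample n G \<xi>))) \<partial>(\<Pi>\<^sub>M i\<in>{1..n}. \<nu>))"

definition minimax_risk :: "real measure \<Rightarrow> nat \<Rightarrow> real set set \<Rightarrow> ennreal" where
  "minimax_risk \<nu> n \<C> = (INF g\<in>set_estimators n. SUP G\<in>\<C>. risk \<nu> n G g)"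

end

theory Submission
  imports Defs
begin

text \<open>
  Lower bound. The design sees a set only through its trace on the grid \<open>{1/n, ..., n/n}\<close>. Two
  segments whose right endpoints lie \<open>1/(2n)\<close> apart inside one grid cell produce the same data, so
  every estimator has risk at least half their distance on one of them, whatever the noise
  (\<open>indistinguishable_sets_lower_bound\<close>, \<open>segments_lower_bound\<close>).

  Upper bound. Least squares over the grid segments \<open>[k/n, l/n]\<close> amounts to maximizing the contrast
  \<open>S(k,l)\<close>, the sum of \<open>2 Y\<^sub>i - 1\<close> over \<open>k < i \<le> l\<close>. Let \<open>(k0,l0)\<close> be the true pair of indices and
  \<open>m\<close> the number of design points on which the pairs \<open>(k,l)\<close> and \<open>(k0,l0)\<close> disagree. Then
  \<open>S(k,l) - S(k0,l0)\<close> equals \<open>-m\<close> plus twice a signed sum of \<open>m\<close> noise terms, and its exponential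
  moment of order \<open>t = 1/(4\<sigma>\<^sup>2)\<close> is at most \<open>exp(-m/(8\<sigma>\<^sup>2))\<close> (\<open>subgaussian_sum_exp_moment\<close>).
  The true segment has length at least \<open>\<mu>\<close>, and this forces \<open>m \<ge> \<mu> d / 4\<close> with
  \<open>d = |k-k0| + |l-l0|\<close>, even for a candidate that misses the true segment altogether
  (\<open>card_sym_diff_index_ranges_ge\<close>).

  The maximizing pair has a nonnegative contrast difference. Its loss is therefore at most the sum,
  over all pairs, of the loss \<open>(d + 2)/n\<close> times \<open>exp(t (S(k,l) - S(k0,l0)))\<close>. Integrating term by
  term bounds the risk by \<open>1/n\<close> times the sum of \<open>(d + 2) r\<^sup>d\<close> over pairs of integers, where
  \<open>r = exp(-\<mu>/(32\<sigma>\<^sup>2)) < 1\<close>. That series converges, and its sum depends only on \<open>\<mu>\<close> and \<open>\<sigma>\<close>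
  (\<open>risk_lse_le\<close>).
\<close>

section \<open>Indistinguishable sets and the lower bound\<close>

lemma sample_measurable:
  assumes "sets \<nu> = sets borel" and "G \<in> sets borel"
  shows "sample n G \<in> measurable (\<Pi>\<^sub>M i\<in>{1..n}. \<nu>) (sample_space n)"
  unfolding sample_def sample_space_def
proof (rule measurable_restrict)
  fix i assume i: "i \<in> {1..n}"
  have "(\<lambda>\<xi>. \<xi> i) \<in> measurable (\<Pi>\<^sub>M i\<in>{1..n}. \<nu>) \<nu>"
    using i by (rule measurable_component_singleton)
  then have [measurable]: "(\<lambda>\<xi>. \<xi> i) \<in> borel_measurable (\<Pi>\<^sub>M i\<in>{1..n}. \<nu>)"
    using measurable_cong_sets[OF refl assms(1)] by blast
  show "(\<lambda>\<xi>. (design n i, indicator G (design n i) + \<xi> i))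
      \<in> borel_measurable (\<Pi>\<^sub>M i\<in>{1..n}. \<nu>)"
    by measurable
qed

lemma emeasure_sym_diff_triangle:
  assumes "A \<in> sets M" and "B \<in> sets M" and "D \<in> sets M"
  shows "emeasure M (sym_diff A B) \<le> emeasure M (sym_diff A D) + emeasure M (sym_diff B D)"
proof -
  have "emeasure M (sym_diff A B) \<le> emeasure M (sym_diff A D \<union> sym_diff B D)"
    using assms by (intro emeasure_mono) auto
  also have "\<dots> \<le> emeasure M (sym_diff A D) + emeasure M (sym_diff B D)"
    using assms by (intro emeasure_subadditive) auto
  finally show ?thesis .
qed

text \<open>
  Both sets induce the same law of the data, so the two risks of an estimator are integrals over
  the same random set. By the triangle inequality they sum to at least the distance of the two sets.
\<close>

lemma indistinguishable_sets_lower_bound: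
  assumes \<nu>: "prob_space \<nu>" "sets \<nu> = sets borel"
    and G: "G \<in> \<C>" "H \<in> \<C>" "G \<in> sets borel" "H \<in> sets borel"
    and same: "\<And>i. i \<in> {1..n} \<Longrightarrow> design n i \<in> G \<longleftrightarrow> design n i \<in> H"
  shows "emeasure lebesgue (sym_diff G H) \<le> 2 * minimax_risk \<nu> n \<C>"
proof -
  interpret \<nu>: prob_space \<nu> by fact
  interpret P: prob_space "\<Pi>\<^sub>M i\<in>{1..n}. \<nu>"
    by (intro prob_space_PiM \<nu>(1))
  have eq: "sample n H = sample n G"
    using same by (auto simp: sample_def fun_eq_iff restrict_def indicator_def)
  have "emeasure lebesgue (sym_diff G H) / 2 \<le> (SUP G\<in>\<C>. risk \<nu> n G g)"
    if g: "g \<in> set_estimators n" for g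
  proof -
    let ?P = "\<Pi>\<^sub>M i\<in>{1..n}. \<nu>"
    let ?A = "\<lambda>\<xi>. g (sample n G \<xi>)"
    have meas: "(\<lambda>\<xi>. emeasure lebesgue (sym_diff K (?A \<xi>))) \<in> borel_measurable ?P"
      if "K \<in> sets borel" for K
      using g that sample_measurable[OF \<nu>(2) G(3)]
      by (auto simp: set_estimators_def intro: measurable_compose)
    have "emeasure lebesgue (sym_diff G H) = (\<integral>\<^sup>+\<xi>. emeasure lebesgue (sym_diff G H) \<partial>?P)"
      by (simp only: nn_integral_const P.emeasure_space_1 mult_1_right)
    also have "\<dots> \<le> (\<integral>\<^sup>+\<xi>. emeasure lebesgue (sym_diff G (?A \<xi>))
                        + emeasure lebesgue (sym_diff H (?A \<xi>)) \<partial>?P)"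
    proof (intro nn_integral_mono emeasure_sym_diff_triangle)
      fix \<xi> assume "\<xi> \<in> space ?P"
      then have "sample n G \<xi> \<in> space (sample_space n)"
        using sample_measurable[OF \<nu>(2) G(3)] by (rule measurable_space[rotated])
      then show "?A \<xi> \<in> sets lebesgue"
        using g by (auto simp: set_estimators_def)
    qed (use G in auto)
    also have "\<dots> = risk \<nu> n G g + risk \<nu> n H g"
      unfolding risk_def eq using G(3,4) by (intro nn_integral_add meas)
    also have "\<dots> \<le> (SUP G\<in>\<C>. risk \<nu> n G g) + (SUP G\<in>\<C>. risk \<nu> n G g)"
      using G by (intro add_mono SUP_upper)
    finally show ?thesis
      by (intro divide_le_posI_ennreal) (simp_all add: mult_2)
  qed
  then have "emeasure lebesgue (sym_diff G H) / 2 \<le> minimax_risk \<nu> n \<C>"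
    unfolding minimax_risk_def by (intro INF_greatest)
  then have "emeasure lebesgue (sym_diff G H) / 2 * 2 \<le> minimax_risk \<nu> n \<C> * 2"
    by (rule mult_right_mono) simp
  then show ?thesis
    by (simp add: ennreal_divide_times mult_divide_eq_ennreal mult.commute[of 2])
qed

text \<open>
  The half-open interval \<open>(1 - 1/n, 1 - 1/(2n)]\<close> contains no design point, so the data cannot tell
  whether a segment ends at \<open>1 - 1/n\<close> or at \<open>1 - 1/(2n)\<close>.
\<close>

lemma segments_lower_bound:
  assumes \<nu>: "prob_space \<nu>" "sets \<nu> = sets borel"
    and n: "n \<ge> 1" "\<mu> \<le> 1 - 1 / real n"
  shows "ennreal (1 / 4 * (1 / real n)) \<le> minimax_risk \<nu> n (segments \<mu>)"
proof -
  define b b' where "b = 1 - 1 / real n" and "b' = 1 - 1 / (2 * real n)"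
  have b: "0 \<le> b" "b < b'" "b' < 1" "b' - b = 1 / (2 * real n)"
    using n by (auto simp: b_def b'_def field_simps)
  have same: "design n i \<in> {0..b} \<longleftrightarrow> design n i \<in> {0..b'}" if "i \<in> {1..n}" for i
  proof (cases "i = n")
    case True
    then show ?thesis using b n by (auto simp: design_def)
  next
    case False
    then have "real i + 1 \<le> real n" using that by auto
    then have "design n i \<le> b"
      using n by (simp add: design_def b_def field_simps)
    then show ?thesis using b by auto
  qed
  have "sym_diff {0..b} {0..b'} = {b<..b'}" using b by auto
  then have "ennreal (1 / (2 * real n)) = emeasure lebesgue (sym_diff {0..b} {0..b'})"
    using b by simp
  also have "\<dots> \<le> 2 * minimax_risk \<nu> n (segments \<mu>)"
  proof (rule indistinguishable_sets_lower_bound[OF \<nu>])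
    show "{0..b} \<in> segments \<mu>" "{0..b'} \<in> segments \<mu>"
      unfolding segments_def using b n(2) unfolding b_def by force+
  qed (use same in auto)
  finally have "ennreal (1 / (2 * real n)) \<le> 2 * minimax_risk \<nu> n (segments \<mu>)" .
  moreover have "ennreal (1 / (2 * real n)) = 2 * ennreal (1 / 4 * (1 / real n))"
    by (simp add: ennreal_mult'[symmetric] flip: ennreal_numeral)
  ultimately show ?thesis
    by (simp add: ennreal_mult_le_mult_iff)
qed

section \<open>The least squares segment\<close>

text \<open>
  Up to a term that does not depend on \<open>k\<close> and \<open>l\<close>, this is the negative residual sum of squares
  of the responses against the indicator of \<open>{k<..l}\<close>.
\<close>

definition contrast :: "(nat \<Rightarrow> real \<times> real) \<Rightarrow> nat \<Rightarrow> nat \<Rightarrow> real" where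
  "contrast s k l = (\<Sum>i\<in>{k<..l}. 2 * snd (s i) - 1)"

definition maximizes_contrast :: "nat \<Rightarrow> (nat \<Rightarrow> real \<times> real) \<Rightarrow> nat \<times> nat \<Rightarrow> bool" where
  "maximizes_contrast n s = (\<lambda>(k, l). k \<le> l \<and> l \<le> n \<and>
     (\<forall>k'\<in>{..n}. \<forall>l'\<in>{..n}. k' \<le> l' \<longrightarrow> contrast s k' l' \<le> contrast s k l))"

text \<open>
  Ties are broken by taking the least code of a maximizing pair, which makes the selection
  measurable.
\<close>

definition lse_index :: "nat \<Rightarrow> (nat \<Rightarrow> real \<times> real) \<Rightarrow> nat" where
  "lse_index n s = (LEAST j. maximizes_contrast n s (prod_decode j))"

definition grid_segment :: "nat \<Rightarrow> nat \<times> nat \<Rightarrow> real set" where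
  "grid_segment n = (\<lambda>(k, l). {real k / real n..real l / real n})"

definition lse :: "nat \<Rightarrow> (nat \<Rightarrow> real \<times> real) \<Rightarrow> real set" where
  "lse n s = grid_segment n (prod_decode (lse_index n s))"

lemma lse_index_maximizes: "maximizes_contrast n s (prod_decode (lse_index n s))"
proof -
  let ?D = "{(k, l). k \<le> l \<and> l \<le> n}"
  let ?f = "\<lambda>(k, l). contrast s k l"
  have "?D \<subseteq> {..n} \<times> {..n}" by auto
  then have fin: "finite ?D" by (rule finite_subset) simp
  have "(0, 0) \<in> ?D" by simp
  then have ne: "?D \<noteq> {}" by blast
  have "Max (?f ` ?D) \<in> ?f ` ?D"
    using fin ne by (intro Max_in) auto
  then obtain p where p: "p \<in> ?D" "?f p = Max (?f ` ?D)" by fastforce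
  have "?f q \<le> ?f p" if "q \<in> ?D" for q
    unfolding p(2) using fin that by (intro Max_ge) auto
  then have "maximizes_contrast n s p"
    using p(1) by (fastforce simp: maximizes_contrast_def)
  then have "maximizes_contrast n s (prod_decode (prod_encode p))" by simp
  then show ?thesis unfolding lse_index_def by (rule LeastI)
qed

lemma contrast_measurable:
  assumes "l \<le> n"
  shows "(\<lambda>s. contrast s k l) \<in> borel_measurable (sample_space n)"
proof -
  have "(\<lambda>s. snd (s i)) \<in> borel_measurable (sample_space n)" if "i \<in> {k<..l}" for i
  proof -
    have "(\<lambda>s. s i) \<in> measurable (sample_space n) borel"
      unfolding sample_space_def using that assms
      by (intro measurable_component_singleton) auto
    then show ?thesis
      by (rule measurable_compose)
        (intro borel_measurable_continuous_onI continuous_intros)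
  qed
  then show ?thesis
    unfolding contrast_def
    by (intro borel_measurable_sum borel_measurable_diff borel_measurable_times
        borel_measurable_const)
qed

lemma lse_index_measurable:
  "lse_index n \<in> measurable (sample_space n) (count_space UNIV)"
proof -
  have "Measurable.pred (sample_space n) (\<lambda>s. maximizes_contrast n s p)" for p
  proof (cases p)
    case (Pair k l)
    show ?thesis
    proof (cases "k \<le> l \<and> l \<le> n")
      case True
      have beats: "Measurable.pred (sample_space n) (\<lambda>s. k' \<le> l' \<longrightarrow> contrast s k' l' \<le> contrast s k l)"
        if "l' \<in> {..n}" for k' l'
      proof -
        have "Measurable.pred (sample_space n) (\<lambda>s. contrast s k' l' \<le> contrast s k l)"
          unfolding Measurable.pred_def
          using that True by (intro borel_measurable_le contrast_measurable) auto
        then show ?thesis by (cases "k' \<le> l'") simp_all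
      qed
      have "Measurable.pred (sample_space n) (\<lambda>s. \<forall>k'\<in>{..n}. \<forall>l'\<in>{..n}.
            k' \<le> l' \<longrightarrow> contrast s k' l' \<le> contrast s k l)"
        by (rule pred_intros_countable_bounded(3), rule pred_intros_countable_bounded(3),
            rule beats)
      moreover have "(\<lambda>s. maximizes_contrast n s p) = (\<lambda>s. \<forall>k'\<in>{..n}. \<forall>l'\<in>{..n}.
            k' \<le> l' \<longrightarrow> contrast s k' l' \<le> contrast s k l)"
        using True by (simp add: maximizes_contrast_def Pair)
      ultimately show ?thesis by (simp only:)
    next
      case False
      then have "(\<lambda>s. maximizes_contrast n s p) = (\<lambda>s. False)"
        by (auto simp: maximizes_contrast_def Pair)
      then show ?thesis by (simp only: measurable_const space_count_space UNIV_I)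
    qed
  qed
  then show ?thesis
    unfolding lse_index_def[abs_def] by (rule measurable_Least)
qed

text \<open>
  The estimator takes countably many values, chosen by a measurable index, so its loss is a
  measurable function whatever the set it is compared with.
\<close>

lemma lse_in_set_estimators:
  assumes "n \<ge> 1"
  shows "lse n \<in> set_estimators n"
proof -
  have "lse n s \<subseteq> {0..1} \<and> lse n s \<in> sets lebesgue" for s
    using lse_index_maximizes[of n s] assms
    by (auto simp: lse_def grid_segment_def maximizes_contrast_def field_simps
        split: prod.splits intro: order_trans)
  moreover have "(\<lambda>s. emeasure lebesgue (sym_diff G (lse n s)))
      \<in> borel_measurable (sample_space n)" for G
    unfolding lse_def by (rule measurable_compose[OF lse_index_measurable]) simp
  ultimately show ?thesis by (simp add: set_estimators_def)
qed

section \<open>Loss in terms of grid indices\<close>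

lemma emeasure_sym_diff_interval_le:
  fixes a b c d :: real
  shows "emeasure lebesgue (sym_diff {a..b} {c..d}) \<le> ennreal (\<bar>a - c\<bar> + \<bar>b - d\<bar>)"
proof -
  have "emeasure lebesgue (sym_diff {a..b} {c..d})
      \<le> emeasure lebesgue ({min a c..max a c} \<union> {min b d..max b d})"
    by (intro emeasure_mono) auto
  also have "\<dots> \<le> emeasure lebesgue {min a c..max a c} + emeasure lebesgue {min b d..max b d}"
    by (intro emeasure_subadditive) auto
  also have "\<dots> = ennreal (max a c - min a c) + ennreal (max b d - min b d)" by simp
  also have "\<dots> = ennreal (\<bar>a - c\<bar> + \<bar>b - d\<bar>)"
    by (subst ennreal_plus[symmetric]) (auto simp: min_def max_def)
  finally show ?thesis .
qed

lemma grid_segment_loss_le: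
  assumes n: "n \<ge> 1"
    and a: "\<bar>real n * a - real k0\<bar> \<le> 1" and b: "\<bar>real n * b - real l0\<bar> \<le> 1"
  shows "emeasure lebesgue (sym_diff {a..b} (grid_segment n (k, l)))
    \<le> ennreal ((\<bar>real k - real k0\<bar> + \<bar>real l - real l0\<bar> + 2) / real n)"
proof -
  have "emeasure lebesgue (sym_diff {a..b} (grid_segment n (k, l)))
      \<le> ennreal (\<bar>a - real k / real n\<bar> + \<bar>b - real l / real n\<bar>)"
    unfolding grid_segment_def prod.case by (rule emeasure_sym_diff_interval_le)
  also have "\<bar>a - real k / real n\<bar> + \<bar>b - real l / real n\<bar>
      = (\<bar>real n * a - real k\<bar> + \<bar>real n * b - real l\<bar>) / real n"
  proof -
    have "\<bar>x - y / real n\<bar> = \<bar>real n * x - y\<bar> / real n" for x y :: real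
    proof -
      have "x - y / real n = (real n * x - y) / real n" using n by (simp add: field_simps)
      then show ?thesis using n by simp
    qed
    then show ?thesis by (simp only: add_divide_distrib)
  qed
  also have "\<dots> \<le> (\<bar>real k - real k0\<bar> + \<bar>real l - real l0\<bar> + 2) / real n"
    using a b by (intro divide_right_mono) auto
  finally show ?thesis by (simp add: ennreal_leI)
qed

text \<open>
  Passing to the grid loses at most one index at each endpoint. Since \<open>\<mu> n \<ge> 2\<close>, at least half of
  the length \<open>\<mu> n\<close> survives.
\<close>

lemma segment_index_range:
  fixes a b :: real
  assumes n: "n \<ge> 1" and ab: "0 \<le> a" "b \<le> 1" "\<mu> \<le> b - a" and \<mu>: "2 \<le> \<mu> * real n"
  obtains k0 l0 where "k0 \<le> l0" "l0 \<le> n" "\<mu> / 2 * real n \<le> real l0 - real k0"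
    "\<bar>real n * a - real k0\<bar> \<le> 1" "\<bar>real n * b - real l0\<bar> \<le> 1"
    "\<And>i. i \<in> {1..n} \<Longrightarrow> design n i \<in> {a..b} \<longleftrightarrow> i \<in> {k0<..l0}"
proof -
  (* k0 is the largest index i with i / n < a; for a = 0, nat truncates -1 to the value 0 needed. *)
  define k0 where "k0 = nat (\<lceil>real n * a\<rceil> - 1)"
  define l0 where "l0 = nat \<lfloor>real n * b\<rfloor>"
  have na: "0 \<le> real n * a" using ab n by simp
  have \<mu>0: "0 < \<mu>" using \<mu> n by (smt (verit) mult_nonpos_nonneg of_nat_0_le_iff)
  have nb: "0 \<le> real n * b" using ab \<mu>0 n by simp
  have nab: "\<mu> * real n \<le> real n * b - real n * a"
    using mult_left_mono[OF ab(3), of "real n"] by (simp add: algebra_simps)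
  have k0: "real n * a - 1 \<le> real k0" "real k0 \<le> real n * a"
    using na unfolding k0_def by linarith+
  have l0: "real n * b - 1 < real l0" "real l0 \<le> real n * b"
    using nb unfolding l0_def by linarith+
  have len: "\<mu> / 2 * real n \<le> real l0 - real k0" using k0 l0 nab \<mu> by argo
  have le: "k0 \<le> l0" using len \<mu> by linarith
  have "real n * b \<le> real n" using ab n by (simp add: mult_left_le)
  then have ln: "l0 \<le> n" using l0 by linarith
  have "design n i \<in> {a..b} \<longleftrightarrow> i \<in> {k0<..l0}" if "i \<in> {1..n}" for i
  proof -
    have "design n i \<in> {a..b} \<longleftrightarrow> real n * a \<le> real i \<and> real i \<le> real n * b"
      using n by (auto simp: design_def field_simps)
    moreover have "real n * a \<le> real i \<longleftrightarrow> k0 < i"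
      using that unfolding k0_def by (auto; linarith)
    moreover have "real i \<le> real n * b \<longleftrightarrow> i \<le> l0"
      using nb unfolding l0_def by linarith
    ultimately show ?thesis by simp
  qed
  with that[OF le ln len] k0 l0 show thesis by auto
qed

text \<open>
  If the two ranges overlap or touch, they differ in exactly the indices between corresponding
  endpoints, so the cardinality is the full distance. Otherwise their difference contains all of
  the range from \<open>k0\<close> to \<open>l0\<close>, which has at least \<open>\<mu> n / 2\<close> elements, while the distance of the
  endpoints never exceeds \<open>2 n\<close>. Covering this second case by the same inequality is what costs the
  factor \<open>\<mu> / 4\<close>.
\<close>

lemma card_sym_diff_index_ranges_ge:
  assumes kl: "k \<le> l" "l \<le> n" "k0 \<le> l0" "l0 \<le> n"
    and \<mu>: "0 \<le> \<mu>" "\<mu> \<le> 1" and len: "\<mu> / 2 * real n \<le> real l0 - real k0"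
  shows "\<mu> / 4 * (\<bar>real k - real k0\<bar> + \<bar>real l - real l0\<bar>)
    \<le> real (card (sym_diff {k<..l} {k0<..l0}))"
proof (cases "max k k0 \<le> min l l0")
  case True
  let ?A = "{min k k0<..max k k0}" and ?B = "{min l l0<..max l l0}"
  have "?A \<union> ?B \<subseteq> sym_diff {k<..l} {k0<..l0}"
    using True by (auto simp: min_def max_def split: if_splits)
  then have "card (?A \<union> ?B) \<le> card (sym_diff {k<..l} {k0<..l0})"
    by (intro card_mono) auto
  moreover have "card (?A \<union> ?B) = card ?A + card ?B"
    using True by (intro card_Un_disjoint) auto
  moreover have "real (card {min i j<..max i j}) = \<bar>real i - real j\<bar>" for i j
    by (simp add: min_def max_def of_nat_diff)
  ultimately have d: "\<bar>real k - real k0\<bar> + \<bar>real l - real l0\<bar>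
      \<le> real (card (sym_diff {k<..l} {k0<..l0}))"
    by (metis of_nat_add of_nat_le_iff)
  have "\<mu> / 4 * (\<bar>real k - real k0\<bar> + \<bar>real l - real l0\<bar>)
      \<le> 1 * (\<bar>real k - real k0\<bar> + \<bar>real l - real l0\<bar>)"
    using \<mu> by (intro mult_right_mono) auto
  with d show ?thesis by simp
next
  case False
  then have "{k0<..l0} \<subseteq> sym_diff {k<..l} {k0<..l0}"
    using kl by auto
  then have "card {k0<..l0} \<le> card (sym_diff {k<..l} {k0<..l0})"
    by (intro card_mono) auto
  then have "real l0 - real k0 \<le> real (card (sym_diff {k<..l} {k0<..l0}))" by simp
  moreover have "\<mu> / 4 * (\<bar>real k - real k0\<bar> + \<bar>real l - real l0\<bar>) \<le> \<mu> / 4 * (2 * real n)"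
    using \<mu> kl by (intro mult_left_mono) auto
  ultimately show ?thesis using len by simp
qed

section \<open>Exponential moments of contrast differences\<close>

lemma sum_indicator_diff_square:
  assumes "finite I" and "sym_diff A B \<subseteq> I"
  shows "(\<Sum>i\<in>I. (indicator A i - indicator B i :: real)\<^sup>2) = real (card (sym_diff A B))"
proof -
  have "(\<Sum>i\<in>I. (indicator A i - indicator B i :: real)\<^sup>2) = (\<Sum>i\<in>I. indicator (sym_diff A B) i)"
    by (intro sum.cong refl) (auto simp: indicator_def)
  also have "\<dots> = real (card (I \<inter> sym_diff A B))"
    unfolding sum_indicator_eq_card[OF assms(1), symmetric] of_nat_sum
    by (intro sum.cong refl) (simp only: indicator_def of_nat_of_bool)
  also have "I \<inter> sym_diff A B = sym_diff A B"
    using assms(2) by blast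
  finally show ?thesis .
qed

text \<open>
  On the true set \<open>2 Y\<^sub>i - 1\<close> has mean \<open>1\<close>, off it \<open>-1\<close>. Every index on which the candidate is wrong
  thus has the drift \<open>-1\<close>, whether it was added or dropped.
\<close>

lemma contrast_difference:
  fixes k l k0 l0 :: nat and \<xi> :: "nat \<Rightarrow> real"
  assumes "l \<le> n" "l0 \<le> n"
    and G: "\<And>i. i \<in> {1..n} \<Longrightarrow> design n i \<in> G \<longleftrightarrow> i \<in> {k0<..l0}"
  defines "e \<equiv> \<lambda>i. indicator {k<..l} i - indicator {k0<..l0} i :: real"
  shows "contrast (sample n G \<xi>) k l - contrast (sample n G \<xi>) k0 l0
    = (\<Sum>i\<in>{1..n}. 2 * e i * \<xi> i - (e i)\<^sup>2)"
proof -
  let ?s = "sample n G \<xi>"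
  have ext: "contrast ?s k l = (\<Sum>i\<in>{1..n}. indicator {k<..l} i * (2 * snd (?s i) - 1))"
    if "l \<le> n" for k l
    unfolding contrast_def using that
    by (intro sum.mono_neutral_cong_left) (auto simp: indicator_def)
  have "contrast ?s k l - contrast ?s k0 l0 = (\<Sum>i\<in>{1..n}. e i * (2 * snd (?s i) - 1))"
    using assms(1,2) by (simp only: ext e_def sum_subtractf[symmetric] left_diff_distrib)
  also have "\<dots> = (\<Sum>i\<in>{1..n}. 2 * e i * \<xi> i - (e i)\<^sup>2)"
    by (intro sum.cong refl)
      (auto simp: sample_def G e_def indicator_def algebra_simps power2_eq_square)
  finally show ?thesis .
qed

text \<open>
  By independence the moment factorizes. For the order \<open>t\<close>, each factor is at most
  \<open>exp(- t e\<^sub>i\<^sup>2 + 2 \<sigma>\<^sup>2 t\<^sup>2 e\<^sub>i\<^sup>2)\<close>, and \<open>t = 1/(4\<sigma>\<^sup>2)\<close> minimizes this exponent.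
\<close>

lemma subgaussian_sum_exp_moment:
  assumes sub: "subgaussian_law \<sigma> \<nu>" and "0 < \<sigma>" and fin: "finite I"
  shows "(\<integral>\<^sup>+\<xi>. ennreal (exp (1 / (4 * \<sigma>\<^sup>2) * (\<Sum>i\<in>I. 2 * e i * \<xi> i - (e i)\<^sup>2))) \<partial>(\<Pi>\<^sub>M i\<in>I. \<nu>))
    \<le> ennreal (exp (- (\<Sum>i\<in>I. (e i)\<^sup>2) / (8 * \<sigma>\<^sup>2)))"
proof -
  interpret \<nu>: prob_space \<nu> using sub by (simp add: subgaussian_law_def)
  interpret product_sigma_finite "\<lambda>_. \<nu>" by unfold_locales
  have [measurable_cong]: "sets \<nu> = sets borel" using sub by (simp add: subgaussian_law_def)
  define t where "t = 1 / (4 * \<sigma>\<^sup>2)"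
  let ?f = "\<lambda>i x. ennreal (exp (t * (2 * e i * x - (e i)\<^sup>2)))"
  have f: "?f i \<in> borel_measurable \<nu>" for i
    by measurable
  have one: "(\<integral>\<^sup>+x. ?f i x \<partial>\<nu>) \<le> ennreal (exp (- (e i)\<^sup>2 / (8 * \<sigma>\<^sup>2)))" for i
  proof -
    define u where "u = 2 * t * e i"
    have int: "integrable \<nu> (\<lambda>x. exp (u * x))"
      and bd: "(\<integral>x. exp (u * x) \<partial>\<nu>) \<le> exp (\<sigma>\<^sup>2 * u\<^sup>2 / 2)"
      using sub by (auto simp: subgaussian_law_def)
    have "(\<integral>\<^sup>+x. ?f i x \<partial>\<nu>) = (\<integral>\<^sup>+x. ennreal (exp (- t * (e i)\<^sup>2) * exp (u * x)) \<partial>\<nu>)"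
      by (simp add: u_def exp_add[symmetric] algebra_simps)
    also have "\<dots> = ennreal (\<integral>x. exp (- t * (e i)\<^sup>2) * exp (u * x) \<partial>\<nu>)"
      using int by (intro nn_integral_eq_integral) auto
    also have "(\<integral>x. exp (- t * (e i)\<^sup>2) * exp (u * x) \<partial>\<nu>)
        \<le> exp (- t * (e i)\<^sup>2) * exp (\<sigma>\<^sup>2 * u\<^sup>2 / 2)"
      using bd by simp
    also have "\<dots> = exp (- (e i)\<^sup>2 / (8 * \<sigma>\<^sup>2))"
      using \<open>0 < \<sigma>\<close> by (simp add: u_def t_def exp_add[symmetric] field_simps power2_eq_square)
    finally show ?thesis by (simp add: ennreal_leI)
  qed
  have "(\<integral>\<^sup>+\<xi>. ennreal (exp (t * (\<Sum>i\<in>I. 2 * e i * \<xi> i - (e i)\<^sup>2))) \<partial>(\<Pi>\<^sub>M i\<in>I. \<nu>))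
      = (\<integral>\<^sup>+\<xi>. (\<Prod>i\<in>I. ?f i (\<xi> i)) \<partial>(\<Pi>\<^sub>M i\<in>I. \<nu>))"
    by (simp add: sum_distrib_left exp_sum[OF fin] prod_ennreal)
  also have "\<dots> = (\<Prod>i\<in>I. \<integral>\<^sup>+x. ?f i x \<partial>\<nu>)"
    using fin f by (rule product_nn_integral_prod)
  also have "\<dots> \<le> (\<Prod>i\<in>I. ennreal (exp (- (e i)\<^sup>2 / (8 * \<sigma>\<^sup>2))))"
    using one by (intro prod_mono_ennreal)
  also have "\<dots> = ennreal (exp (- (\<Sum>i\<in>I. (e i)\<^sup>2) / (8 * \<sigma>\<^sup>2)))"
    by (simp add: prod_ennreal exp_sum[OF fin, symmetric] sum_negf sum_divide_distrib)
  finally show ?thesis unfolding t_def .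
qed

section \<open>A convergent double series\<close>

text \<open>Every distance to \<open>m\<close> is attained at most once on each side of \<open>m\<close>.\<close>

lemma sum_abs_diff_le_suminf:
  fixes f :: "nat \<Rightarrow> real"
  assumes "summable f" and nn: "\<And>j. 0 \<le> f j"
  shows "(\<Sum>k\<le>n. f (nat \<bar>int k - int m\<bar>)) \<le> 2 * suminf f"
proof -
  have part: "(\<Sum>k\<in>K. f (nat \<bar>int k - int m\<bar>)) \<le> suminf f"
    if "finite K" "inj_on (\<lambda>k. nat \<bar>int k - int m\<bar>) K" for K
  proof -
    have "(\<Sum>k\<in>K. f (nat \<bar>int k - int m\<bar>)) = sum f ((\<lambda>k. nat \<bar>int k - int m\<bar>) ` K)"
      using that by (simp add: sum.reindex)
    also have "\<dots> \<le> suminf f" using that assms by (intro sum_le_suminf) auto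
    finally show ?thesis .
  qed
  have "{..n} = {k\<in>{..n}. k \<le> m} \<union> {k\<in>{..n}. m < k}" by auto
  then have "(\<Sum>k\<le>n. f (nat \<bar>int k - int m\<bar>))
      = (\<Sum>k\<in>{k\<in>{..n}. k \<le> m}. f (nat \<bar>int k - int m\<bar>))
      + (\<Sum>k\<in>{k\<in>{..n}. m < k}. f (nat \<bar>int k - int m\<bar>))"
    by (metis (no_types, lifting) finite_Un finite_atMost sum.union_disjoint
        disjoint_iff mem_Collect_eq not_le)
  also have "\<dots> \<le> suminf f + suminf f"
    by (intro add_mono part) (auto simp: inj_on_def)
  finally show ?thesis by simp
qed

text \<open>
  Since \<open>p + q + 2 \<le> 2 (p + 1) (q + 1)\<close>, the double sum is dominated by a product of two single sums.
\<close>

lemma sum_pairs_geometric_le: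
  fixes r :: real
  assumes r: "0 < r" "r < 1"
  shows "(\<Sum>k\<le>n. \<Sum>l\<le>n. (\<bar>real k - real k0\<bar> + \<bar>real l - real l0\<bar> + 2)
            * r powr (\<bar>real k - real k0\<bar> + \<bar>real l - real l0\<bar>))
    \<le> 8 * (\<Sum>j. real (Suc j) * r ^ j)\<^sup>2"
proof -
  define f where "f = (\<lambda>j. real (Suc j) * r ^ j)"
  have sf: "summable f"
    unfolding f_def using geometric_deriv_sums[of r] r by (simp add: sums_iff)
  have nn: "0 \<le> f j" for j using r by (simp add: f_def)
  have dist: "\<bar>real k - real m\<bar> = real (nat \<bar>int k - int m\<bar>)" for k m by linarith
  let ?D = "\<lambda>k m. nat \<bar>int k - int m\<bar>"
  have term_le: "(\<bar>real k - real k0\<bar> + \<bar>real l - real l0\<bar> + 2)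
        * r powr (\<bar>real k - real k0\<bar> + \<bar>real l - real l0\<bar>)
      \<le> 2 * (f (?D k k0) * f (?D l l0))" for k l
  proof -
    define p q where "p = ?D k k0" and "q = ?D l l0"
    have "real p + real q + 2 \<le> 2 * (real (Suc p) * real (Suc q))"
      by (simp add: algebra_simps)
    then have "(real p + real q + 2) * r ^ (p + q) \<le> 2 * (real (Suc p) * real (Suc q)) * r ^ (p + q)"
      using r by (intro mult_right_mono) auto
    moreover have "r powr (real p + real q) = r ^ (p + q)"
      using r by (simp add: powr_realpow flip: of_nat_add)
    ultimately show ?thesis
      unfolding dist p_def[symmetric] q_def[symmetric] f_def by (simp add: power_add algebra_simps)
  qed
  have "(\<Sum>k\<le>n. \<Sum>l\<le>n. (\<bar>real k - real k0\<bar> + \<bar>real l - real l0\<bar> + 2)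
            * r powr (\<bar>real k - real k0\<bar> + \<bar>real l - real l0\<bar>))
      \<le> (\<Sum>k\<le>n. \<Sum>l\<le>n. 2 * (f (?D k k0) * f (?D l l0)))"
    by (intro sum_mono term_le)
  also have "\<dots> = 2 * ((\<Sum>k\<le>n. f (?D k k0)) * (\<Sum>l\<le>n. f (?D l l0)))"
    by (subst sum_product) (simp add: sum_distrib_left)
  also have "\<dots> \<le> 2 * ((2 * suminf f) * (2 * suminf f))"
    using sf nn by (intro mult_left_mono mult_mono sum_abs_diff_le_suminf sum_nonneg)
      (auto intro!: suminf_nonneg)
  finally show ?thesis unfolding f_def by (simp add: power2_eq_square)
qed

section \<open>The upper bound\<close>

text \<open>
  Weighting each candidate's loss by the exponential of its contrast difference turns the random
  choice of the maximizer into a deterministic sum, so that only exponential moments of individual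
  candidates are needed. The bound is the same for all noise laws with parameter \<open>\<sigma>\<close> and for all
  segments in the class.
\<close>

lemma risk_lse_le:
  assumes \<mu>: "0 < \<mu>" "\<mu> < 1" and \<sigma>: "0 < \<sigma>"
    and sub: "subgaussian_law \<sigma> \<nu>" and n: "n \<ge> 1" "2 \<le> \<mu> * real n"
    and G: "G \<in> segments \<mu>"
  defines "r \<equiv> exp (- \<mu> / (32 * \<sigma>\<^sup>2))"
  shows "risk \<nu> n G (lse n) \<le> ennreal (8 * (\<Sum>j. real (Suc j) * r ^ j)\<^sup>2 * (1 / real n))"
proof -
  obtain a b where ab: "G = {a..b}" "0 \<le> a" "b \<le> 1" "\<mu> \<le> b - a"
    using G by (auto simp: segments_def)
  obtain k0 l0 where kl0: "k0 \<le> l0" "l0 \<le> n" and len: "\<mu> / 2 * real n \<le> real l0 - real k0"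
    and close: "\<bar>real n * a - real k0\<bar> \<le> 1" "\<bar>real n * b - real l0\<bar> \<le> 1"
    and idx: "\<And>i. i \<in> {1..n} \<Longrightarrow> design n i \<in> G \<longleftrightarrow> i \<in> {k0<..l0}"
    using segment_index_range[OF n(1) ab(2-4) n(2)] ab(1) by metis
  let ?P = "\<Pi>\<^sub>M i\<in>{1..n}. \<nu>"
  define t where "t = 1 / (4 * \<sigma>\<^sup>2)"
  define dist where "dist k l = \<bar>real k - real k0\<bar> + \<bar>real l - real l0\<bar>" for k l
  define L where "L k l = (dist k l + 2) / real n" for k l
  have L0: "0 \<le> L k l" for k l by (simp add: L_def dist_def)
  define \<Delta> where "\<Delta> k l \<xi> = contrast (sample n G \<xi>) k l - contrast (sample n G \<xi>) k0 l0" for k l \<xi>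
  define D where "D = {(k, l). k \<le> l \<and> l \<le> n}"
  have "D \<subseteq> {..n} \<times> {..n}" by (auto simp: D_def)
  then have finD: "finite D" by (rule finite_subset) simp
  have pointwise: "emeasure lebesgue (sym_diff G (lse n (sample n G \<xi>)))
      \<le> (\<Sum>(k, l)\<in>D. ennreal (L k l) * ennreal (exp (t * \<Delta> k l \<xi>)))" for \<xi>
  proof -
    let ?s = "sample n G \<xi>"
    obtain k l where kl: "prod_decode (lse_index n ?s) = (k, l)" by (meson surj_pair)
    have max: "maximizes_contrast n ?s (k, l)"
      using lse_index_maximizes[of n ?s] kl by simp
    then have D: "(k, l) \<in> D" by (simp add: maximizes_contrast_def D_def)
    have "0 \<le> \<Delta> k l \<xi>"
      using max kl0 by (auto simp: maximizes_contrast_def \<Delta>_def)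
    then have "1 \<le> exp (t * \<Delta> k l \<xi>)" by (simp add: t_def)
    have "emeasure lebesgue (sym_diff G (lse n ?s)) \<le> ennreal (L k l)"
      using grid_segment_loss_le[OF n(1) close, of k l, folded ab(1)]
      by (simp only: lse_def kl L_def dist_def)
    also have "\<dots> \<le> ennreal (L k l * exp (t * \<Delta> k l \<xi>))"
      using mult_left_mono[OF \<open>1 \<le> exp (t * \<Delta> k l \<xi>)\<close> L0[of k l]] by (simp add: ennreal_leI)
    also have "\<dots> = (\<lambda>(k, l). ennreal (L k l) * ennreal (exp (t * \<Delta> k l \<xi>))) (k, l)"
      using L0 by (simp add: ennreal_mult)
    also have "\<dots> \<le> (\<Sum>(k, l)\<in>D. ennreal (L k l) * ennreal (exp (t * \<Delta> k l \<xi>)))"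
      using D finD by (intro member_le_sum) auto
    finally show ?thesis .
  qed
  have moment: "(\<integral>\<^sup>+\<xi>. ennreal (exp (t * \<Delta> k l \<xi>)) \<partial>?P) \<le> ennreal (r powr dist k l)"
    if "(k, l) \<in> D" for k l
  proof -
    have kl: "k \<le> l" "l \<le> n" using that by (auto simp: D_def)
    let ?e = "\<lambda>i. indicator {k<..l} i - indicator {k0<..l0} i :: real"
    have "(\<Sum>i\<in>{1..n}. (?e i)\<^sup>2) = real (card (sym_diff {k<..l} {k0<..l0}))"
      using kl kl0 by (intro sum_indicator_diff_square) auto
    then have e2: "\<mu> / 4 * dist k l \<le> (\<Sum>i\<in>{1..n}. (?e i)\<^sup>2)"
      using card_sym_diff_index_ranges_ge[OF kl kl0 _ _ len] \<mu> unfolding dist_def by simp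
    have diff: "\<Delta> k l \<xi> = (\<Sum>i\<in>{1..n}. 2 * ?e i * \<xi> i - (?e i)\<^sup>2)" for \<xi>
      unfolding \<Delta>_def by (rule contrast_difference[OF kl(2) kl0(2)]) (rule idx)
    have "(\<integral>\<^sup>+\<xi>. ennreal (exp (t * \<Delta> k l \<xi>)) \<partial>?P)
        \<le> ennreal (exp (- (\<Sum>i\<in>{1..n}. (?e i)\<^sup>2) / (8 * \<sigma>\<^sup>2)))"
      unfolding t_def diff
      by (rule subgaussian_sum_exp_moment[OF sub \<sigma>]) simp
    also have "exp (- (\<Sum>i\<in>{1..n}. (?e i)\<^sup>2) / (8 * \<sigma>\<^sup>2)) \<le> exp (- (\<mu> / 4 * dist k l) / (8 * \<sigma>\<^sup>2))"
      unfolding exp_le_cancel_iff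
      by (rule divide_right_mono) (simp only: neg_le_iff_le e2, simp)
    also have "\<dots> = r powr dist k l"
      by (simp add: r_def powr_def)
    finally show ?thesis by (simp add: ennreal_leI)
  qed
  have sets: "sets \<nu> = sets borel" using sub by (simp add: subgaussian_law_def)
  have Gb: "G \<in> sets borel" using ab by simp
  have meas: "(\<lambda>\<xi>. ennreal (exp (t * \<Delta> k l \<xi>))) \<in> borel_measurable ?P" if "(k, l) \<in> D" for k l
  proof -
    have [measurable]: "\<Delta> k l \<in> borel_measurable ?P"
      unfolding \<Delta>_def[abs_def] using that kl0
      by (intro borel_measurable_diff measurable_compose[OF sample_measurable[OF sets Gb]]
          contrast_measurable) (auto simp: D_def)
    show ?thesis by measurable
  qed
  have "risk \<nu> n G (lse n)
      \<le> (\<integral>\<^sup>+\<xi>. (\<Sum>(k, l)\<in>D. ennreal (L k l) * ennreal (exp (t * \<Delta> k l \<xi>))) \<partial>?P)"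
    unfolding risk_def by (intro nn_integral_mono pointwise)
  also have "\<dots> = (\<Sum>(k, l)\<in>D. ennreal (L k l) * (\<integral>\<^sup>+\<xi>. ennreal (exp (t * \<Delta> k l \<xi>)) \<partial>?P))"
    using meas by (subst nn_integral_sum) (auto simp: nn_integral_cmult intro!: sum.cong)
  also have "\<dots> \<le> (\<Sum>(k, l)\<in>D. ennreal (L k l) * ennreal (r powr dist k l))"
    using moment by (intro sum_mono) (auto intro!: mult_left_mono)
  also have "\<dots> \<le> (\<Sum>(k, l)\<in>{..n} \<times> {..n}. ennreal (L k l) * ennreal (r powr dist k l))"
    using \<open>D \<subseteq> {..n} \<times> {..n}\<close> by (intro sum_mono2) auto
  also have "\<dots> = ennreal (\<Sum>(k, l)\<in>{..n} \<times> {..n}. L k l * r powr dist k l)"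
    using L0 by (subst sum_ennreal[symmetric]) (auto simp: ennreal_mult intro!: sum.cong)
  also have "(\<Sum>(k, l)\<in>{..n} \<times> {..n}. L k l * r powr dist k l)
      = (\<Sum>k\<le>n. \<Sum>l\<le>n. (dist k l + 2) * r powr dist k l) * (1 / real n)"
    by (simp add: sum.cartesian_product[symmetric] L_def sum_divide_distrib)
  also have "\<dots> \<le> 8 * (\<Sum>j. real (Suc j) * r ^ j)\<^sup>2 * (1 / real n)"
    unfolding dist_def using \<mu> \<sigma>
    by (intro mult_right_mono sum_pairs_geometric_le) (auto simp: r_def)
  finally show ?thesis by (simp add: ennreal_leI)
qed

section \<open>The minimax rate\<close>

theorem theorem9:
  fixes \<mu> \<sigma> :: real
  assumes "0 < \<mu>" and "\<mu> < 1" and "0 < \<sigma>"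
  shows "\<exists>c>0. \<exists>C>0. \<forall>\<^sub>F n in sequentially. \<forall>\<nu>. subgaussian_law \<sigma> \<nu> \<longrightarrow>
           ennreal (c * (1 / real n)) \<le> minimax_risk \<nu> n (segments \<mu>) \<and>
           minimax_risk \<nu> n (segments \<mu>) \<le> ennreal (C * (1 / real n))"
proof -
  define r where "r = exp (- \<mu> / (32 * \<sigma>\<^sup>2))"
  have r: "0 < r" "r < 1" using assms by (auto simp: r_def)
  have sr: "summable (\<lambda>j. real (Suc j) * r ^ j)"
    using geometric_deriv_sums[of r] r by (simp add: sums_iff)
  define C where "C = 8 * (\<Sum>j. real (Suc j) * r ^ j)\<^sup>2"
  have "0 < (\<Sum>j. real (Suc j) * r ^ j)"
    using sr r by (intro suminf_pos) auto
  then have C: "0 < C" by (simp add: C_def)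
  (* From 2 / \<mu> on, the rounding to the grid keeps half of every segment; from 1 / (1 - \<mu>) on, the
     two segments of the lower bound are long enough. *)
  have "\<forall>\<^sub>F n in sequentially. max (2 / \<mu>) (1 / (1 - \<mu>)) \<le> real n"
    using filterlim_real_sequentially unfolding filterlim_at_top by blast
  then have "\<forall>\<^sub>F n in sequentially. \<forall>\<nu>. subgaussian_law \<sigma> \<nu> \<longrightarrow>
      ennreal (1 / 4 * (1 / real n)) \<le> minimax_risk \<nu> n (segments \<mu>) \<and>
      minimax_risk \<nu> n (segments \<mu>) \<le> ennreal (C * (1 / real n))"
    using eventually_ge_at_top[of 1]
  proof (eventually_elim, intro allI impI conjI)
    fix n :: nat and \<nu> :: "real measure"
    assume n: "max (2 / \<mu>) (1 / (1 - \<mu>)) \<le> real n" "1 \<le> n" and sub: "subgaussian_law \<sigma> \<nu>"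
    have n1: "\<mu> \<le> 1 - 1 / real n" and n2: "2 \<le> \<mu> * real n"
      using n assms by (auto simp: field_simps)
    show "ennreal (1 / 4 * (1 / real n)) \<le> minimax_risk \<nu> n (segments \<mu>)"
      using sub n(2) n1 by (intro segments_lower_bound) (auto simp: subgaussian_law_def)
    have "minimax_risk \<nu> n (segments \<mu>) \<le> (SUP G\<in>segments \<mu>. risk \<nu> n G (lse n))"
      unfolding minimax_risk_def using n(2) by (intro INF_lower lse_in_set_estimators)
    also have "\<dots> \<le> ennreal (C * (1 / real n))"
      unfolding C_def r_def using assms sub n(2) n2 by (intro SUP_least risk_lse_le)
    finally show "minimax_risk \<nu> n (segments \<mu>) \<le> ennreal (C * (1 / real n))" .
  qed
  with C show ?thesis
    by (intro exI[of _ "1 / 4 :: real"] conjI exI[of _ C]) auto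
qed

end
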